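(* Let $X,Y$ be topological spaces. The following canonical maps are monotone: (1) $\pi_R:([X,Y],\leqq_R)\to([X,Y]_R,\leqq'_R)$, $\pi_R([f]):=[f]_R$; (2) $\pi_L:([X,Y],\leqq_L)\to([X,Y]_L,\leqq'_L)$, $\pi_L([f]):=[f]_L$; (3) $\pi_{LR}:([X,Y],\leqq_{LR})\to([X,Y]_{LR},\leqq'_{LR})$, $\pi_{LR}([f]):=[f]_{LR}$. Hence each of them is a continuous map from a topological space (namely the Alexandroff space given by the source with its Alexandroff topology) to a poset with the Alexandroff topology; that is, each gives a poset-stratified space structure on the homotopy set $[X,Y]$.
   Context: $[X,Y]$ is the set of homotopy classes $[f]$ of continuous maps $f:X\to Y$. On it define the preorders: $[f]\leqq_R[g]$ iff there is $[s]\in[X,X]$ with $[f]=[g]\circ[s]$; $[f]\leqq_L[g]$ iff there is $[t]\in[Y,Y]$ with $[f]=[t]\circ[g]$; $[f]\leqq_{LR}[g]$ iff there are $[s]\in[X,X]$ and $[t]\in[Y,Y]$ with $[f]=[t]\circ[g]\circ[s]$. For $\bullet\in\{R,L,LR\}$, let $[f]\sim_\bullet[g]$ iff $[f]\leqq_\bullet[g]$ and $[g]\leqq_\bullet[f]$ (an equivalence relation), $[X,Y]_\bullet=[X,Y]/\sim_\bullet$, with $[f]_\bullet$ the class of $[f]$, and define the partial order $[f]_\bullet\leqq'_\bullet[g]_\bullet$ iff $[f]\leqq_\bullet[g]$. For a preordered set $(P,\leqq)$, the Alexandroff topology $\tau_\leqq$ has as open sets exactly the upward closed subsets ($x\in U$,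 $x\leqq y\Rightarrow y\in U$). An Alexandroff space is a topological space in which arbitrary intersections of open sets are open. A poset-stratified space is a pair $(S,S\xrightarrow{\pi}P)$ of a topological space $S$ and a continuous map $\pi$ to a poset $P$ with its Alexandroff topology. *)

theory Defs
  imports "HOL-Analysis.Analysis"
begin

section \<open>Homotopy sets\<close>

text \<open>Functions that agree on \<open>topspace X\<close> are identified by \<open>homotopic_with (\<lambda>_. True) X Y\<close>, so the
  values of a HOL function outside \<open>topspace X\<close> do not affect its class.\<close>

definition homotopy_rel :: "'a topology \<Rightarrow> 'b topology \<Rightarrow> (('a \<Rightarrow> 'b) \<times> ('a \<Rightarrow> 'b)) set" where
  "homotopy_rel X Y = {(f, g). homotopic_with (\<lambda>_. True) X Y f g}"

definition homotopy_class :: "'a topology \<Rightarrow> 'b topology \<Rightarrow> ('a \<Rightarrow> 'b) \<Rightarrow> ('a \<Rightarrow> 'b) set" where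
  "homotopy_class X Y f = homotopy_rel X Y `` {f}"

definition homotopy_set :: "'a topology \<Rightarrow> 'b topology \<Rightarrow> ('a \<Rightarrow> 'b) set set" where
  "homotopy_set X Y = {f. continuous_map X Y f} // homotopy_rel X Y"

text \<open>Composition \<open>[Y,Z] \<times> [X,Y] \<rightarrow> [X,Z]\<close>. The union is over equal sets, since the class of
  \<open>g \<circ> f\<close> does not depend on the representatives; see \<open>homotopy_comp_class\<close> below.\<close>

definition homotopy_comp ::
  "'a topology \<Rightarrow> 'c topology \<Rightarrow> ('b \<Rightarrow> 'c) set \<Rightarrow> ('a \<Rightarrow> 'b) set \<Rightarrow> ('a \<Rightarrow> 'c) set" where
  "homotopy_comp X Z b a = (\<Union>g\<in>b. \<Union>f\<in>a. homotopy_class X Z (g \<circ> f))"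

lemma equiv_homotopy_rel: "equiv {f. continuous_map X Y f} (homotopy_rel X Y)"
proof (rule equivI)
  show "homotopy_rel X Y \<subseteq> {f. continuous_map X Y f} \<times> {f. continuous_map X Y f}"
    by (auto simp: homotopy_rel_def dest: homotopic_with_imp_continuous_maps)
  show "refl_on {f. continuous_map X Y f} (homotopy_rel X Y)"
    by (auto simp: homotopy_rel_def refl_on_def)
  show "sym (homotopy_rel X Y)"
    by (auto simp: homotopy_rel_def sym_def homotopic_with_sym)
  show "trans (homotopy_rel X Y)"
    by (auto simp: homotopy_rel_def trans_def intro: homotopic_with_trans)
qed

lemma homotopy_class_eq_iff:
  assumes "continuous_map X Y f" "continuous_map X Y g"
  shows "homotopy_class X Y f = homotopy_class X Y g \<longleftrightarrow> homotopic_with (\<lambda>_. True) X Y f g"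
  using eq_equiv_class_iff[OF equiv_homotopy_rel, of f X Y g] assms
  by (simp add: homotopy_class_def homotopy_rel_def)

lemma homotopy_set_eq: "homotopy_set X Y = homotopy_class X Y ` {f. continuous_map X Y f}"
  by (auto simp: homotopy_set_def homotopy_class_def quotient_def)

lemma homotopy_comp_class:
  assumes f: "continuous_map X Y f" and g: "continuous_map Y Z g"
  shows "homotopy_comp X Z (homotopy_class Y Z g) (homotopy_class X Y f) = homotopy_class X Z (g \<circ> f)"
proof -
  have eq: "homotopy_class X Z (g' \<circ> f') = homotopy_class X Z (g \<circ> f)"
    if "f' \<in> homotopy_class X Y f" "g' \<in> homotopy_class Y Z g" for f' g'
  proof -
    have ff: "homotopic_with (\<lambda>_. True) X Y f f'" and gg: "homotopic_with (\<lambda>_. True) Y Z g g'"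
      using that by (auto simp: homotopy_class_def homotopy_rel_def)
    then have c: "continuous_map X Y f'" "continuous_map Y Z g'"
      by (auto dest: homotopic_with_imp_continuous_maps)
    have "homotopic_with (\<lambda>_. True) X Z (g \<circ> f) (g \<circ> f')"
      by (rule homotopic_with_compose_continuous_map_left[OF ff g]) simp
    moreover have "homotopic_with (\<lambda>_. True) X Z (g \<circ> f') (g' \<circ> f')"
      by (rule homotopic_with_compose_continuous_map_right[OF gg c(1)]) simp
    ultimately have "homotopic_with (\<lambda>_. True) X Z (g \<circ> f) (g' \<circ> f')"
      by (rule homotopic_with_trans)
    then show ?thesis
      using homotopy_class_eq_iff homotopic_with_imp_continuous_maps by metis
  qed
  have "f \<in> homotopy_class X Y f" "g \<in> homotopy_class Y Z g"
    using f g by (auto simp: homotopy_class_def homotopy_rel_def)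
  then show ?thesis
    unfolding homotopy_comp_def using eq by blast
qed

section \<open>The preorders on \<open>[X,Y]\<close>\<close>

definition homotopy_le_R :: "'a topology \<Rightarrow> 'b topology \<Rightarrow> ('a \<Rightarrow> 'b) set rel" where
  "homotopy_le_R X Y = {(a, b). a \<in> homotopy_set X Y \<and> b \<in> homotopy_set X Y \<and>
     (\<exists>s\<in>homotopy_set X X. a = homotopy_comp X Y b s)}"

definition homotopy_le_L :: "'a topology \<Rightarrow> 'b topology \<Rightarrow> ('a \<Rightarrow> 'b) set rel" where
  "homotopy_le_L X Y = {(a, b). a \<in> homotopy_set X Y \<and> b \<in> homotopy_set X Y \<and>
     (\<exists>t\<in>homotopy_set Y Y. a = homotopy_comp X Y t b)}"

definition homotopy_le_LR :: "'a topology \<Rightarrow> 'b topology \<Rightarrow> ('a \<Rightarrow> 'b) set rel" where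
  "homotopy_le_LR X Y = {(a, b). a \<in> homotopy_set X Y \<and> b \<in> homotopy_set X Y \<and>
     (\<exists>s\<in>homotopy_set X X. \<exists>t\<in>homotopy_set Y Y.
        a = homotopy_comp X Y t (homotopy_comp X Y b s))}"

section \<open>The poset associated with a preordered set\<close>

definition preorder_sim :: "'a rel \<Rightarrow> 'a rel" where
  "preorder_sim r = {(x, y). (x, y) \<in> r \<and> (y, x) \<in> r}"

definition preorder_proj :: "'a rel \<Rightarrow> 'a \<Rightarrow> 'a set" where
  "preorder_proj r x = preorder_sim r `` {x}"

definition preorder_quotient :: "'a set \<Rightarrow> 'a rel \<Rightarrow> 'a set set" where
  "preorder_quotient A r = A // preorder_sim r"

text \<open>Some pair of representatives is related iff every pair is; see
  \<open>preorder_quotient_le_iff\<close> below.\<close>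

definition preorder_quotient_le :: "'a set \<Rightarrow> 'a rel \<Rightarrow> 'a set rel" where
  "preorder_quotient_le A r =
     {(preorder_proj r x, preorder_proj r y) | x y. x \<in> A \<and> y \<in> A \<and> (x, y) \<in> r}"

lemma equiv_preorder_sim: "preorder_on A r \<Longrightarrow> equiv A (preorder_sim r)"
  by (rule equivI)
     (auto simp: preorder_on_def preorder_sim_def refl_on_def sym_def intro!: transI elim: transD)

lemma preorder_quotient_le_iff:
  assumes r: "preorder_on A r" and x: "x \<in> A" and y: "y \<in> A"
  shows "(preorder_proj r x, preorder_proj r y) \<in> preorder_quotient_le A r \<longleftrightarrow> (x, y) \<in> r"
proof
  assume "(preorder_proj r x, preorder_proj r y) \<in> preorder_quotient_le A r"
  then obtain x' y' where *: "x' \<in> A" "y' \<in> A" "(x', y') \<in> r"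
      "preorder_proj r x = preorder_proj r x'" "preorder_proj r y = preorder_proj r y'"
    unfolding preorder_quotient_le_def by blast
  have "(x, x') \<in> r" "(y', y) \<in> r"
    using eq_equiv_class_iff[OF equiv_preorder_sim[OF r]] * x y
    unfolding preorder_proj_def by (auto simp: preorder_sim_def)
  with *(3) show "(x, y) \<in> r"
    using r unfolding preorder_on_def by (meson transD)
qed (use x y in \<open>auto simp: preorder_quotient_le_def\<close>)

section \<open>Alexandroff topologies and poset-stratified spaces\<close>

definition alexandroff_topology :: "'a set \<Rightarrow> 'a rel \<Rightarrow> 'a topology" where
  "alexandroff_topology A r =
     topology (\<lambda>U. U \<subseteq> A \<and> (\<forall>x\<in>U. \<forall>y\<in>A. (x, y) \<in> r \<longrightarrow> y \<in> U))"

lemma openin_alexandroff_topology: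
  "openin (alexandroff_topology A r) U \<longleftrightarrow>
     U \<subseteq> A \<and> (\<forall>x\<in>U. \<forall>y\<in>A. (x, y) \<in> r \<longrightarrow> y \<in> U)"
proof -
  have "istopology (\<lambda>U. U \<subseteq> A \<and> (\<forall>x\<in>U. \<forall>y\<in>A. (x, y) \<in> r \<longrightarrow> y \<in> U))"
    unfolding istopology_def by blast
  then show ?thesis
    by (simp add: alexandroff_topology_def)
qed

lemma topspace_alexandroff_topology: "topspace (alexandroff_topology A r) = A"
  unfolding topspace_def openin_alexandroff_topology by blast

text \<open>The empty intersection is excluded because \<open>\<Inter>{}\<close> is \<open>UNIV\<close> in HOL rather than \<open>topspace T\<close>;
  \<open>topspace T\<close> is open in any case.\<close>

definition alexandroff_space :: "'a topology \<Rightarrow> bool" where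
  "alexandroff_space T \<longleftrightarrow>
     (\<forall>\<U>. \<U> \<noteq> {} \<and> (\<forall>U\<in>\<U>. openin T U) \<longrightarrow> openin T (\<Inter>\<U>))"

definition poset_stratified_space ::
  "'a topology \<Rightarrow> 'b set \<Rightarrow> 'b rel \<Rightarrow> ('a \<Rightarrow> 'b) \<Rightarrow> bool" where
  "poset_stratified_space S P r p \<longleftrightarrow>
     partial_order_on P r \<and> continuous_map S (alexandroff_topology P r) p"

text \<open>Monotone maps between preordered sets, including that \<open>f\<close> maps \<open>A\<close> into \<open>B\<close>.\<close>

definition preorder_map :: "'a set \<Rightarrow> 'a rel \<Rightarrow> 'b set \<Rightarrow> 'b rel \<Rightarrow> ('a \<Rightarrow> 'b) \<Rightarrow> bool" where
  "preorder_map A r B s f \<longleftrightarrow>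
     preorder_on A r \<and> preorder_on B s \<and> f \<in> A \<rightarrow> B \<and>
     monotone_on A (\<lambda>x y. (x, y) \<in> r) (\<lambda>x y. (x, y) \<in> s) f"

end

theory Submission
  imports Defs
begin

text \<open>
  Homotopy classes compose associatively and have identities. Hence \<open>[X,X]\<close> and \<open>[Y,Y]\<close> are monoids
  acting on \<open>[X,Y]\<close> from the right and from the left, and the two actions commute. Each of the three
  relations says that one class lies in the orbit of another under such an action: identities
  make the relation reflexive and products of acting elements make it transitive.

  The rest holds for every preorder \<open>r\<close> on a set \<open>A\<close>. The order on the quotient is defined through
  representatives, so the projection is monotone; antisymmetry holds in the quotient because mutually
  related elements have been identified. Finally, the preimage of an up-set under a monotone map
  is an up-set, which turns monotonicity into continuity for the Alexandroff topologies.
\<close>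

section \<open>Composition of homotopy classes\<close>

lemma homotopy_set_cases:
  assumes "a \<in> homotopy_set X Y"
  obtains f where "continuous_map X Y f" "a = homotopy_class X Y f"
  using assms by (auto simp: homotopy_set_eq)

lemma homotopy_comp_closed:
  assumes "a \<in> homotopy_set X Y" "b \<in> homotopy_set Y Z"
  shows "homotopy_comp X Z b a \<in> homotopy_set X Z"
proof -
  obtain f where f: "continuous_map X Y f" "a = homotopy_class X Y f"
    using assms(1) by (rule homotopy_set_cases)
  obtain g where g: "continuous_map Y Z g" "b = homotopy_class Y Z g"
    using assms(2) by (rule homotopy_set_cases)
  show ?thesis
    unfolding f(2) g(2) homotopy_comp_class[OF f(1) g(1)]
    using continuous_map_compose[OF f(1) g(1)] by (simp add: homotopy_set_eq)
qed

lemma homotopy_comp_assoc: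
  assumes "a \<in> homotopy_set X Y" "b \<in> homotopy_set Y Z" "c \<in> homotopy_set Z W"
  shows "homotopy_comp X W c (homotopy_comp X Z b a) = homotopy_comp X W (homotopy_comp Y W c b) a"
proof -
  obtain f where f: "continuous_map X Y f" "a = homotopy_class X Y f"
    using assms(1) by (rule homotopy_set_cases)
  obtain g where g: "continuous_map Y Z g" "b = homotopy_class Y Z g"
    using assms(2) by (rule homotopy_set_cases)
  obtain h where h: "continuous_map Z W h" "c = homotopy_class Z W h"
    using assms(3) by (rule homotopy_set_cases)
  show ?thesis
    unfolding f(2) g(2) h(2) homotopy_comp_class[OF f(1) g(1)] homotopy_comp_class[OF g(1) h(1)]
      homotopy_comp_class[OF continuous_map_compose[OF f(1) g(1)] h(1)]
      homotopy_comp_class[OF f(1) continuous_map_compose[OF g(1) h(1)]]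
    by (simp only: comp_assoc)
qed

lemma homotopy_class_id_in: "homotopy_class X X id \<in> homotopy_set X X"
  by (simp add: homotopy_set_eq)

lemma homotopy_comp_id_right:
  "a \<in> homotopy_set X Y \<Longrightarrow> homotopy_comp X Y a (homotopy_class X X id) = a"
  by (auto elim!: homotopy_set_cases simp: homotopy_comp_class)

lemma homotopy_comp_id_left:
  "a \<in> homotopy_set X Y \<Longrightarrow> homotopy_comp X Y (homotopy_class Y Y id) a = a"
  by (auto elim!: homotopy_set_cases simp: homotopy_comp_class)

section \<open>The three preorders\<close>

lemma preorder_homotopy_le_R: "preorder_on (homotopy_set X Y) (homotopy_le_R X Y)"
  unfolding preorder_on_def
proof (intro conjI)
  show "homotopy_le_R X Y \<subseteq> homotopy_set X Y \<times> homotopy_set X Y"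
    by (auto simp: homotopy_le_R_def)
  show "refl_on (homotopy_set X Y) (homotopy_le_R X Y)"
  proof (rule refl_onI)
    fix a assume a: "a \<in> homotopy_set X Y"
    show "(a, a) \<in> homotopy_le_R X Y"
      unfolding homotopy_le_R_def
      using a homotopy_class_id_in homotopy_comp_id_right[OF a, symmetric] by blast
  qed
  show "trans (homotopy_le_R X Y)"
  proof (rule transI)
    fix a b c
    assume "(a, b) \<in> homotopy_le_R X Y" "(b, c) \<in> homotopy_le_R X Y"
    then obtain s s' where
      in_set: "a \<in> homotopy_set X Y" "c \<in> homotopy_set X Y"
      and s: "s \<in> homotopy_set X X" "a = homotopy_comp X Y b s"
      and s': "s' \<in> homotopy_set X X" "b = homotopy_comp X Y c s'"
      by (auto simp: homotopy_le_R_def)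
    have "a = homotopy_comp X Y c (homotopy_comp X X s' s)"
      using homotopy_comp_assoc[OF s(1) s'(1) in_set(2)] s(2) s'(2) by simp
    then show "(a, c) \<in> homotopy_le_R X Y"
      using in_set homotopy_comp_closed[OF s(1) s'(1)] by (auto simp: homotopy_le_R_def)
  qed
qed

lemma preorder_homotopy_le_L: "preorder_on (homotopy_set X Y) (homotopy_le_L X Y)"
  unfolding preorder_on_def
proof (intro conjI)
  show "homotopy_le_L X Y \<subseteq> homotopy_set X Y \<times> homotopy_set X Y"
    by (auto simp: homotopy_le_L_def)
  show "refl_on (homotopy_set X Y) (homotopy_le_L X Y)"
  proof (rule refl_onI)
    fix a assume a: "a \<in> homotopy_set X Y"
    show "(a, a) \<in> homotopy_le_L X Y"
      unfolding homotopy_le_L_def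
      using a homotopy_class_id_in homotopy_comp_id_left[OF a, symmetric] by blast
  qed
  show "trans (homotopy_le_L X Y)"
  proof (rule transI)
    fix a b c
    assume "(a, b) \<in> homotopy_le_L X Y" "(b, c) \<in> homotopy_le_L X Y"
    then obtain t t' where
      in_set: "a \<in> homotopy_set X Y" "c \<in> homotopy_set X Y"
      and t: "t \<in> homotopy_set Y Y" "a = homotopy_comp X Y t b"
      and t': "t' \<in> homotopy_set Y Y" "b = homotopy_comp X Y t' c"
      by (auto simp: homotopy_le_L_def)
    have "a = homotopy_comp X Y (homotopy_comp Y Y t t') c"
      using homotopy_comp_assoc[OF in_set(2) t'(1) t(1)] t(2) t'(2) by simp
    then show "(a, c) \<in> homotopy_le_L X Y"
      using in_set homotopy_comp_closed[OF t'(1) t(1)] by (auto simp: homotopy_le_L_def)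
  qed
qed

text \<open>The relation \<open>\<le>\<^sub>L\<^sub>R\<close> is the relational composite of \<open>\<le>\<^sub>L\<close> and \<open>\<le>\<^sub>R\<close>. Because the left and the right
  action commute, a step along \<open>\<le>\<^sub>R\<close> followed by one along \<open>\<le>\<^sub>L\<close> can be traded for two steps in the
  opposite order; this reduces transitivity of the composite to transitivity of the factors.\<close>

lemma homotopy_le_LR_eq_L_O_R: "homotopy_le_LR X Y = homotopy_le_L X Y O homotopy_le_R X Y"
proof (intro equalityI subrelI)
  fix a b assume "(a, b) \<in> homotopy_le_LR X Y"
  then show "(a, b) \<in> homotopy_le_L X Y O homotopy_le_R X Y"
    unfolding homotopy_le_LR_def homotopy_le_L_def homotopy_le_R_def
    using homotopy_comp_closed by blast
next
  fix a b assume "(a, b) \<in> homotopy_le_L X Y O homotopy_le_R X Y"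
  then show "(a, b) \<in> homotopy_le_LR X Y"
    unfolding homotopy_le_LR_def homotopy_le_L_def homotopy_le_R_def by auto
qed

lemma homotopy_le_R_O_L_subset:
  "homotopy_le_R X Y O homotopy_le_L X Y \<subseteq> homotopy_le_L X Y O homotopy_le_R X Y"
proof (rule subrelI)
  fix a c assume "(a, c) \<in> homotopy_le_R X Y O homotopy_le_L X Y"
  then obtain s t where
    in_set: "a \<in> homotopy_set X Y" "c \<in> homotopy_set X Y"
    and s: "s \<in> homotopy_set X X" and t: "t \<in> homotopy_set Y Y"
    and a: "a = homotopy_comp X Y (homotopy_comp X Y t c) s"
    by (auto simp: homotopy_le_R_def homotopy_le_L_def)
  have "a = homotopy_comp X Y t (homotopy_comp X Y c s)"
    using a homotopy_comp_assoc[OF s in_set(2) t] by simp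
  then show "(a, c) \<in> homotopy_le_L X Y O homotopy_le_R X Y"
    using in_set s t unfolding homotopy_le_LR_eq_L_O_R[symmetric] homotopy_le_LR_def by auto
qed

lemma preorder_homotopy_le_LR: "preorder_on (homotopy_set X Y) (homotopy_le_LR X Y)"
proof -
  let ?A = "homotopy_set X Y" and ?L = "homotopy_le_L X Y" and ?R = "homotopy_le_R X Y"
  have L: "?L \<subseteq> ?A \<times> ?A" "refl_on ?A ?L" "trans ?L"
    and R: "?R \<subseteq> ?A \<times> ?A" "refl_on ?A ?R" "trans ?R"
    using preorder_homotopy_le_L[of X Y] preorder_homotopy_le_R[of X Y]
    by (auto simp: preorder_on_def)
  have "(?L O ?R) O (?L O ?R) = ?L O (?R O ?L) O ?R"
    by (simp add: O_assoc)
  also have "\<dots> \<subseteq> ?L O (?L O ?R) O ?R"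
    by (intro relcomp_mono homotopy_le_R_O_L_subset order_refl)
  also have "\<dots> = (?L O ?L) O (?R O ?R)"
    by (simp add: O_assoc)
  also have "\<dots> \<subseteq> ?L O ?R"
    using L(3) R(3) by (intro relcomp_mono trans_O_subset)
  finally have "trans (?L O ?R)"
    unfolding trans_def by blast
  moreover have "refl_on ?A (?L O ?R)"
    using L(2) R(2) by (auto simp: refl_on_def)
  moreover have "?L O ?R \<subseteq> ?A \<times> ?A"
    using L(1) R(1) by blast
  ultimately show ?thesis
    by (simp add: preorder_on_def homotopy_le_LR_eq_L_O_R)
qed

section \<open>The quotient poset and Alexandroff topologies\<close>

lemma preorder_quotient_eq: "preorder_quotient A r = preorder_proj r ` A"
  by (auto simp: preorder_quotient_def quotient_def preorder_proj_def)

lemma partial_order_preorder_quotient: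
  assumes r: "preorder_on A r"
  shows "partial_order_on (preorder_quotient A r) (preorder_quotient_le A r)"
  unfolding partial_order_on_def preorder_on_def
proof (intro conjI)
  let ?Q = "preorder_quotient A r" and ?le = "preorder_quotient_le A r"
  note le_iff = preorder_quotient_le_iff[OF r]
  have r_refl: "(x, x) \<in> r" if "x \<in> A" for x
    using r that by (auto simp: preorder_on_def refl_on_def)
  have r_trans: "trans r"
    using r by (simp add: preorder_on_def)
  show subset: "?le \<subseteq> ?Q \<times> ?Q"
    by (auto simp: preorder_quotient_le_def preorder_quotient_eq)
  show "refl_on ?Q ?le"
    by (auto simp: refl_on_def preorder_quotient_eq le_iff r_refl)
  show "trans ?le"
  proof (rule transI)
    fix p q u assume le: "(p, q) \<in> ?le" "(q, u) \<in> ?le"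
    then obtain x y z where "x \<in> A" "y \<in> A" "z \<in> A"
      and "p = preorder_proj r x" "q = preorder_proj r y" "u = preorder_proj r z"
      using subset unfolding preorder_quotient_eq by blast
    with le show "(p, u) \<in> ?le"
      by (auto simp: le_iff intro: transD[OF r_trans])
  qed
  show "antisym ?le"
  proof (rule antisymI)
    fix p q assume le: "(p, q) \<in> ?le" "(q, p) \<in> ?le"
    then obtain x y where xy: "x \<in> A" "y \<in> A"
      and pq: "p = preorder_proj r x" "q = preorder_proj r y"
      using subset unfolding preorder_quotient_eq by blast
    with le have "(x, y) \<in> preorder_sim r"
      by (simp add: le_iff preorder_sim_def)
    then show "p = q"
      unfolding pq preorder_proj_def by (rule equiv_class_eq[OF equiv_preorder_sim[OF r]])
  qed
qed

lemma preorder_map_proj: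
  assumes r: "preorder_on A r"
  shows "preorder_map A r (preorder_quotient A r) (preorder_quotient_le A r) (preorder_proj r)"
  using r partial_order_preorder_quotient[OF r]
  by (auto simp: preorder_map_def partial_order_on_def preorder_quotient_eq
      monotone_on_def preorder_quotient_le_iff)

lemma alexandroff_space_alexandroff_topology: "alexandroff_space (alexandroff_topology A r)"
  unfolding alexandroff_space_def openin_alexandroff_topology by blast

lemma continuous_map_alexandroff_topology:
  assumes "preorder_map A r B s f"
  shows "continuous_map (alexandroff_topology A r) (alexandroff_topology B s) f"
  using assms
  unfolding continuous_map_def topspace_alexandroff_topology openin_alexandroff_topology
    preorder_map_def monotone_on_def
  by blast

lemma poset_stratified_space_preorder_proj:
  assumes "preorder_on A r"
  shows "poset_stratified_space (alexandroff_topology A r)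
    (preorder_quotient A r) (preorder_quotient_le A r) (preorder_proj r)"
  unfolding poset_stratified_space_def
  using partial_order_preorder_quotient[OF assms]
    continuous_map_alexandroff_topology[OF preorder_map_proj[OF assms]] by blast

section \<open>Poset-stratified structures on the homotopy set\<close>

theorem proposition3p5:
  fixes X :: "'a topology" and Y :: "'b topology"
  shows
    "\<forall>r\<in>{homotopy_le_R X Y, homotopy_le_L X Y, homotopy_le_LR X Y}.
       preorder_map (homotopy_set X Y) r
         (preorder_quotient (homotopy_set X Y) r) (preorder_quotient_le (homotopy_set X Y) r)
         (preorder_proj r) \<and>
       topspace (alexandroff_topology (homotopy_set X Y) r) = homotopy_set X Y \<and>
       alexandroff_space (alexandroff_topology (homotopy_set X Y) r) \<and>
       continuous_map
         (alexandroff_topology (homotopy_set X Y) r)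
         (alexandroff_topology
            (preorder_quotient (homotopy_set X Y) r) (preorder_quotient_le (homotopy_set X Y) r))
         (preorder_proj r) \<and>
       poset_stratified_space
         (alexandroff_topology (homotopy_set X Y) r)
         (preorder_quotient (homotopy_set X Y) r) (preorder_quotient_le (homotopy_set X Y) r)
         (preorder_proj r)"
proof
  fix r assume "r \<in> {homotopy_le_R X Y, homotopy_le_L X Y, homotopy_le_LR X Y}"
  then have r: "preorder_on (homotopy_set X Y) r"
    using preorder_homotopy_le_R preorder_homotopy_le_L preorder_homotopy_le_LR by blast
  show "preorder_map (homotopy_set X Y) r
         (preorder_quotient (homotopy_set X Y) r) (preorder_quotient_le (homotopy_set X Y) r)
         (preorder_proj r) \<and>
       topspace (alexandroff_topology (homotopy_set X Y) r) = homotopy_set X Y \<and>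
       alexandroff_space (alexandroff_topology (homotopy_set X Y) r) \<and>
       continuous_map
         (alexandroff_topology (homotopy_set X Y) r)
         (alexandroff_topology
            (preorder_quotient (homotopy_set X Y) r) (preorder_quotient_le (homotopy_set X Y) r))
         (preorder_proj r) \<and>
       poset_stratified_space
         (alexandroff_topology (homotopy_set X Y) r)
         (preorder_quotient (homotopy_set X Y) r) (preorder_quotient_le (homotopy_set X Y) r)
         (preorder_proj r)"
    by (intro conjI preorder_map_proj[OF r] topspace_alexandroff_topology
        alexandroff_space_alexandroff_topology
        continuous_map_alexandroff_topology[OF preorder_map_proj[OF r]]
        poset_stratified_space_preorder_proj[OF r])
qed

end
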